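(* Let $X$ be a locally finite poset and $K$ a field. Assume that $X$ has an all-comparable element $x_0$. If $\lambda\in\mathrm{Aut}(X)$ is such that for all $x\in X$ $$\big((x_0\le x\text{ and }\lambda(x_0)\le x)\ \text{ or }\ (x\le x_0\text{ and }\lambda(x)\le x_0)\big)\ \Rightarrow\ \lambda(x)\le x,$$ then $H^1_{(\sigma,\lambda)}(X,K)=\{0\}$ for any multiplicative $\sigma\in I(X,K)$.
   Context: A poset is locally finite if all its intervals $\{z: x\le z\le y\}$ are finite. An element $x_0\in X$ is all-comparable if for every $x\in X$ either $x_0\le x$ or $x_0\ge x$. $\mathrm{Aut}(X)$ is the group of bijections $\lambda:X\to X$ with $x\le y\iff\lambda(x)\le\lambda(y)$. The incidence algebra $I(X,K)$ is the $K$-space of functions $f:X\times X\to K$ with $f(x,y)=0$ for $x\nleq y$, with product $(fg)(x,y)=\sum_{x\le z\le y}f(x,z)g(z,y)$. An element $\sigma\in I(X,K)$ is multiplicative if $\sigma(x,y)\ne 0$ for all $x\le y$ and $\sigma(x,z)=\sigma(x,y)\sigma(y,z)$ whenever $x\le y\le z$. Cohomology: for $n>0$ let $X^n_\le=\{(x_0,\dots,x_{n-1})\in X^n: x_0\le\dots\le x_{n-1}\}$. For $n\ge0$ let $C^n(X,K)$ be the $K$-space of all functions $f:X^{n+1}_\le\to K$ and $C^n_\lambda(X,K)=\{f\in C^n(X,K): f(x_0,\dots,x_n)=0\text{ if }\lambda(x_0)\nleq x_n\}$. Define $\delta^n_{(\sigma,\lambda)}:C^n(X,K)\to C^{n+1}(X,K)$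 by $$(\delta^n_{(\sigma,\lambda)}f)(x_0,\dots,x_{n+1})=\sigma(\lambda(x_0),\lambda(x_1))f(x_1,\dots,x_{n+1})+\sum_{i=1}^{n+1}(-1)^if(x_0,\dots,\widehat{x_i},\dots,x_{n+1}),$$ where $\widehat{x_i}$ means that $x_i$ is removed. These maps restrict to a cochain complex $C^0_\lambda(X,K)\to C^1_\lambda(X,K)\to\cdots$. For this complex, $Z^n_{(\sigma,\lambda)}(X,K)=\ker\delta^n_{(\sigma,\lambda)}\subseteq C^n_\lambda(X,K)$ for $n\ge0$, $B^n_{(\sigma,\lambda)}(X,K)=\delta^{n-1}_{(\sigma,\lambda)}(C^{n-1}_\lambda(X,K))$ and $H^n_{(\sigma,\lambda)}(X,K)=Z^n_{(\sigma,\lambda)}(X,K)/B^n_{(\sigma,\lambda)}(X,K)$ for $n>0$. *)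

theory Defs
  imports Main "HOL-Library.Function_Algebras" "HOL-Library.Set_Algebras"
begin

text \<open>
  A poset \<open>X\<close> is a type of class \<^class>\<open>order\<close>, a field \<open>K\<close> a type of class \<^class>\<open>field\<close>.
\<close>

definition all_comparable :: "'a::order \<Rightarrow> bool" where
  "all_comparable x0 \<longleftrightarrow> (\<forall>x. x0 \<le> x \<or> x \<le> x0)"

definition Aut :: "('a::order \<Rightarrow> 'a) set" where
  "Aut = {l. bij l \<and> (\<forall>x y. x \<le> y \<longleftrightarrow> l x \<le> l y)}"

text \<open>
  The underlying \<open>K\<close>-space of the incidence algebra; multiplicativity of an element does
  not involve the convolution product.
\<close>

definition incidence_algebra :: "('a::order \<Rightarrow> 'a \<Rightarrow> 'k::field) set" where
  "incidence_algebra = {f. \<forall>x y. \<not> x \<le> y \<longrightarrow> f x y = 0}"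

definition multiplicative :: "('a::order \<Rightarrow> 'a \<Rightarrow> 'k::field) \<Rightarrow> bool" where
  "multiplicative s \<longleftrightarrow> s \<in> incidence_algebra \<and>
     (\<forall>x y. x \<le> y \<longrightarrow> s x y \<noteq> 0) \<and>
     (\<forall>x y z. x \<le> y \<longrightarrow> y \<le> z \<longrightarrow> s x z = s x y * s y z)"

text \<open>\<open>chains n\<close> is \<open>X\<^sup>n\<^sub>\<le>\<close>, with \<open>n\<close>-tuples as lists of length \<open>n\<close>.\<close>

definition chains :: "nat \<Rightarrow> 'a::order list set" where
  "chains n = {xs. length xs = n \<and> sorted_wrt (\<le>) xs}"

text \<open>
  A function on \<open>X\<^sup>n\<^sup>+\<^sup>1\<^sub>\<le>\<close> is represented by its extension by \<open>0\<close> to all lists, so that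
  equality and the pointwise vector space operations are those of the function type.
\<close>

definition cochains :: "nat \<Rightarrow> ('a::order list \<Rightarrow> 'k::field) set" where
  "cochains n = {f. \<forall>xs. xs \<notin> chains (n + 1) \<longrightarrow> f xs = 0}"

definition cochains_at :: "('a::order \<Rightarrow> 'a) \<Rightarrow> nat \<Rightarrow> ('a list \<Rightarrow> 'k::field) set" where
  "cochains_at l n =
     {f \<in> cochains n. \<forall>xs \<in> chains (n + 1). \<not> l (xs ! 0) \<le> xs ! n \<longrightarrow> f xs = 0}"

definition remove_nth :: "nat \<Rightarrow> 'a list \<Rightarrow> 'a list" where
  "remove_nth i xs = take i xs @ drop (Suc i) xs"

definition delta ::
  "('a::order \<Rightarrow> 'a \<Rightarrow> 'k::field) \<Rightarrow> ('a \<Rightarrow> 'a) \<Rightarrow> nat \<Rightarrow> ('a list \<Rightarrow> 'k) \<Rightarrow> 'a list \<Rightarrow> 'k" where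
  "delta s l n f = (\<lambda>xs.
     if xs \<in> chains (n + 2)
     then s (l (xs ! 0)) (l (xs ! 1)) * f (remove_nth 0 xs)
            + (\<Sum>i = 1..n + 1. (-1) ^ i * f (remove_nth i xs))
     else 0)"

definition cocycles ::
  "('a::order \<Rightarrow> 'a \<Rightarrow> 'k::field) \<Rightarrow> ('a \<Rightarrow> 'a) \<Rightarrow> nat \<Rightarrow> ('a list \<Rightarrow> 'k) set" where
  "cocycles s l n = {f \<in> cochains_at l n. delta s l n f = 0}"

text \<open>Coboundaries and cohomology are meaningful for \<open>n > 0\<close> only.\<close>

definition coboundaries ::
  "('a::order \<Rightarrow> 'a \<Rightarrow> 'k::field) \<Rightarrow> ('a \<Rightarrow> 'a) \<Rightarrow> nat \<Rightarrow> ('a list \<Rightarrow> 'k) set" where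
  "coboundaries s l n = delta s l (n - 1) ` cochains_at l (n - 1)"

text \<open>
  The quotient space as the set of cosets \<open>f + B\<close>; its zero is the coset of the zero cocycle.
\<close>

definition cohomology ::
  "('a::order \<Rightarrow> 'a \<Rightarrow> 'k::field) \<Rightarrow> ('a \<Rightarrow> 'a) \<Rightarrow> nat \<Rightarrow> ('a list \<Rightarrow> 'k) set set" where
  "cohomology s l n = (\<lambda>f. f +o coboundaries s l n) ` cocycles s l n"

definition cohomology_zero ::
  "('a::order \<Rightarrow> 'a \<Rightarrow> 'k::field) \<Rightarrow> ('a \<Rightarrow> 'a) \<Rightarrow> nat \<Rightarrow> ('a list \<Rightarrow> 'k) set" where
  "cohomology_zero s l n = 0 +o coboundaries s l n"

end

theory Submission
  imports Defs
begin

text \<open>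
  A \<open>1\<close>-cocycle is a function \<open>f\<close> on pairs \<open>x \<le> y\<close> with
  \<open>f(x,z) = f(x,y) + \<sigma>(\<lambda>x,\<lambda>y) f(y,z)\<close>, and it is a coboundary when it has a potential \<open>g\<close>,
  that is, \<open>f(x,y) = \<sigma>(\<lambda>x,\<lambda>y) g(y) - g(x)\<close>. Since every element is comparable with \<open>x\<^sub>0\<close>, one
  may normalise \<open>g(x\<^sub>0) = 0\<close> and integrate \<open>f\<close> from \<open>x\<^sub>0\<close>: the potential equation for the pair
  formed by \<open>x\<close> and \<open>x\<^sub>0\<close> leaves no choice but \<open>g(x) = -f(x,x\<^sub>0)\<close> below \<open>x\<^sub>0\<close> and
  \<open>g(x) = f(x\<^sub>0,x) / \<sigma>(\<lambda>x\<^sub>0,\<lambda>x)\<close> above. The cocycle identity for the triple \<open>x\<close>, \<open>y\<close>, \<open>x\<^sub>0\<close>,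
  arranged in increasing order, is then the potential equation for \<open>x \<le> y\<close>
  (\<open>delta_cocycle_potential\<close>).

  The hypothesis on \<open>\<lambda>\<close> is what makes \<open>g\<close> an element of \<open>C\<^sup>0\<^sub>\<lambda>\<close>: if \<open>\<lambda>(x) \<le> x\<close> fails, it
  forces \<open>\<lambda>(x) \<le> x\<^sub>0\<close> to fail (for \<open>x \<le> x\<^sub>0\<close>), respectively \<open>\<lambda>(x\<^sub>0) \<le> x\<close> (for \<open>x\<^sub>0 \<le> x\<close>), so
  the value of \<open>f \<in> C\<^sup>1\<^sub>\<lambda>\<close> that defines \<open>g(x)\<close> is \<open>0\<close>
  (\<open>cocycle_potential_in_cochains_at\<close>).
\<close>

lemma zero_in_cochains_at: "0 \<in> cochains_at l n"
  by (simp add: cochains_at_def cochains_def)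

lemma add_in_cochains_at:
  assumes "f \<in> cochains_at l n" and "g \<in> cochains_at l n"
  shows "f + g \<in> cochains_at l n"
  using assms by (simp add: cochains_at_def cochains_def)

lemma diff_in_cochains_at:
  assumes "f \<in> cochains_at l n" and "g \<in> cochains_at l n"
  shows "f - g \<in> cochains_at l n"
  using assms by (simp add: cochains_at_def cochains_def)

lemma delta_zero: "delta s l n 0 = 0"
  by (simp add: delta_def fun_eq_iff)

lemma delta_add: "delta s l n (f + g) = delta s l n f + delta s l n g"
  by (auto simp: delta_def fun_eq_iff algebra_simps sum.distrib)

lemma delta_diff: "delta s l n (f - g) = delta s l n f - delta s l n g"
  by (auto simp: delta_def fun_eq_iff algebra_simps sum_subtractf)

lemma coboundary_translate:
  assumes "f \<in> coboundaries s l n"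
  shows "f +o coboundaries s l n = coboundaries s l n"
proof -
  from assms obtain g where g: "g \<in> cochains_at l (n - 1)" and f: "f = delta s l (n - 1) g"
    by (auto simp: coboundaries_def)
  show ?thesis
  proof (intro equalityI subsetI)
    fix h assume "h \<in> f +o coboundaries s l n"
    then obtain k where k: "k \<in> cochains_at l (n - 1)" and "h = f + delta s l (n - 1) k"
      by (auto simp: coboundaries_def elt_set_plus_def)
    then have "h = delta s l (n - 1) (g + k)" by (simp add: f delta_add)
    then show "h \<in> coboundaries s l n"
      using add_in_cochains_at[OF g k] by (auto simp: coboundaries_def)
  next
    fix h assume "h \<in> coboundaries s l n"
    then obtain k where k: "k \<in> cochains_at l (n - 1)" and h: "h = delta s l (n - 1) k"
      by (auto simp: coboundaries_def)
    have "h = f + delta s l (n - 1) (k - g)" by (simp add: f h delta_diff)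
    then show "h \<in> f +o coboundaries s l n"
      using diff_in_cochains_at[OF k g] by (auto simp: coboundaries_def elt_set_plus_def)
  qed
qed

lemma cohomology_trivialI:
  assumes "cocycles s l n \<subseteq> coboundaries s l n"
  shows "cohomology s l n = {cohomology_zero s l n}"
proof -
  have zero: "0 \<in> cocycles s l n"
    by (simp add: cocycles_def zero_in_cochains_at delta_zero)
  have "f +o coboundaries s l n = cohomology_zero s l n" if "f \<in> cocycles s l n" for f
    using that zero assms by (simp add: cohomology_zero_def coboundary_translate subset_iff)
  with zero show ?thesis unfolding cohomology_def by blast
qed

lemma delta_0_pair:
  assumes "x \<le> y"
  shows "delta s l 0 g [x, y] = s (l x) (l y) * g [y] - g [x]"
  using assms by (simp add: delta_def chains_def remove_nth_def)

lemma delta_1_triple: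
  assumes "x \<le> y" and "y \<le> z"
  shows "delta s l 1 f [x, y, z] = s (l x) (l y) * f [y, z] - f [x, z] + f [x, y]"
proof -
  have "x \<le> z" using assms by (rule order_trans)
  with assms show ?thesis
    by (simp add: delta_def chains_def remove_nth_def numeral_2_eq_2)
qed

lemma chains_1_iff: "xs \<in> chains (Suc 0) \<longleftrightarrow> (\<exists>x. xs = [x])"
  by (auto simp: chains_def length_Suc_conv)

lemma chains_2_iff: "xs \<in> chains (Suc (Suc 0)) \<longleftrightarrow> (\<exists>x y. x \<le> y \<and> xs = [x, y])"
  by (auto simp: chains_def length_Suc_conv)

lemma cocycle_add:
  assumes "f \<in> cocycles s l 1" and "x \<le> y" and "y \<le> z"
  shows "f [x, z] = f [x, y] + s (l x) (l y) * f [y, z]"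
proof -
  have "delta s l 1 f [x, y, z] = 0"
    using assms(1) by (simp add: cocycles_def)
  with delta_1_triple[OF assms(2,3), of s l f] show ?thesis by (simp add: algebra_simps)
qed

lemma cocycle_eq_0:
  assumes "f \<in> cocycles s l 1" and "\<not> l x \<le> y"
  shows "f [x, y] = 0"
proof -
  have "[x, y] \<in> chains (1 + 1) \<Longrightarrow> \<not> l ([x, y] ! 0) \<le> [x, y] ! 1 \<Longrightarrow> f [x, y] = 0"
    and "[x, y] \<notin> chains (1 + 1) \<Longrightarrow> f [x, y] = 0"
    using assms(1) unfolding cocycles_def cochains_at_def cochains_def by blast+
  with assms(2) show ?thesis by auto
qed

definition cocycle_potential ::
  "('a::order \<Rightarrow> 'a \<Rightarrow> 'k::field) \<Rightarrow> ('a \<Rightarrow> 'a) \<Rightarrow> 'a \<Rightarrow> ('a list \<Rightarrow> 'k) \<Rightarrow> 'a list \<Rightarrow> 'k" where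
  "cocycle_potential s l x0 f xs =
     (if xs \<in> chains 1
      then let x = xs ! 0 in if x \<le> x0 then - f [x, x0] else f [x0, x] / s (l x0) (l x)
      else 0)"

lemma cocycle_potential_below:
  "x \<le> x0 \<Longrightarrow> cocycle_potential s l x0 f [x] = - f [x, x0]"
  by (simp add: cocycle_potential_def chains_1_iff)

text \<open>
  At \<open>x = x0\<close> the two formulas agree because a cocycle vanishes on constant pairs.
\<close>

lemma cocycle_potential_above:
  assumes f: "f \<in> cocycles s l 1" and s: "s (l x0) (l x0) \<noteq> 0" and "x0 \<le> x"
  shows "cocycle_potential s l x0 f [x] = f [x0, x] / s (l x0) (l x)"
proof (cases "x \<le> x0")
  case True
  with \<open>x0 \<le> x\<close> have "x = x0" by simp
  moreover have "f [x0, x0] = 0"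
    using cocycle_add[OF f order_refl order_refl, of x0] s by simp
  ultimately show ?thesis by (simp add: cocycle_potential_below)
next
  case False
  then show ?thesis by (simp add: cocycle_potential_def chains_1_iff)
qed

lemma cocycle_potential_in_cochains_at:
  assumes f: "f \<in> cocycles s l 1"
    and comparable: "all_comparable x0"
    and below: "\<And>x. x \<le> x0 \<Longrightarrow> l x \<le> x0 \<Longrightarrow> l x \<le> x"
    and above: "\<And>x. x0 \<le> x \<Longrightarrow> l x0 \<le> x \<Longrightarrow> l x \<le> x"
  shows "cocycle_potential s l x0 f \<in> cochains_at l 0"
proof -
  have "cocycle_potential s l x0 f [x] = 0" if "\<not> l x \<le> x" for x
  proof (cases "x \<le> x0")
    case True
    with that below have "\<not> l x \<le> x0" by blast
    with f True show ?thesis by (simp add: cocycle_potential_below cocycle_eq_0)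
  next
    case False
    with comparable have "x0 \<le> x" by (auto simp: all_comparable_def)
    with that above have "\<not> l x0 \<le> x" by blast
    with f False show ?thesis by (simp add: cocycle_potential_def chains_1_iff cocycle_eq_0)
  qed
  moreover have "cocycle_potential s l x0 f xs = 0" if "xs \<notin> chains 1" for xs
    using that by (simp add: cocycle_potential_def)
  ultimately show ?thesis
    by (auto simp: cochains_at_def cochains_def chains_1_iff)
qed

text \<open>
  The three cases are the positions of \<open>x0\<close> relative to \<open>x \<le> y\<close>; each is the cocycle identity for
  the resulting triple. When \<open>x0\<close> is not the largest of the three, multiplicativity of \<open>s\<close> along the
  image of the triple under \<open>l\<close> absorbs the denominators.
\<close>

lemma delta_cocycle_potential:
  assumes f: "f \<in> cocycles s l 1"
    and comparable: "all_comparable x0"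
    and "mono l"
    and s: "multiplicative s"
  shows "delta s l 0 (cocycle_potential s l x0 f) = f"
proof
  fix xs
  let ?g = "cocycle_potential s l x0 f"
  have nonzero: "s (l x) (l y) \<noteq> 0" if "x \<le> y" for x y
    using s monoD[OF \<open>mono l\<close> that] unfolding multiplicative_def by blast
  have mult: "s (l x) (l z) = s (l x) (l y) * s (l y) (l z)" if "x \<le> y" "y \<le> z" for x y z
    using s monoD[OF \<open>mono l\<close> that(1)] monoD[OF \<open>mono l\<close> that(2)]
    unfolding multiplicative_def by blast
  note above = cocycle_potential_above[OF f nonzero[OF order_refl]]
  show "delta s l 0 ?g xs = f xs"
  proof (cases "xs \<in> chains (Suc (Suc 0))")
    case False
    moreover have "f xs = 0"
    proof -
      have "xs \<notin> chains (1 + 1)" using False by simp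
      with f show ?thesis unfolding cocycles_def cochains_at_def cochains_def by blast
    qed
    ultimately show ?thesis by (simp add: delta_def)
  next
    case True
    then obtain x y where xs: "xs = [x, y]" and "x \<le> y" by (auto simp: chains_2_iff)
    have "s (l x) (l y) * ?g [y] - ?g [x] = f [x, y]"
    proof -
      consider "y \<le> x0" | "x \<le> x0" "x0 \<le> y" | "x0 \<le> x"
        using comparable by (auto simp: all_comparable_def)
      then show ?thesis
      proof cases
        case 1
        with \<open>x \<le> y\<close> have "x \<le> x0" by simp
        with 1 show ?thesis
          using cocycle_add[OF f \<open>x \<le> y\<close> 1] by (simp add: cocycle_potential_below)
      next
        case 2
        have "s (l x) (l y) * ?g [y] = s (l x) (l x0) * f [x0, y]"
          using 2 nonzero[OF 2(2)] by (simp add: above mult[OF 2])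
        with 2 show ?thesis
          using cocycle_add[OF f 2] by (simp add: cocycle_potential_below)
      next
        case 3
        with \<open>x \<le> y\<close> have "x0 \<le> y" by simp
        have "s (l x) (l y) * ?g [y] = f [x0, y] / s (l x0) (l x)"
          using \<open>x0 \<le> y\<close> nonzero[OF \<open>x \<le> y\<close>] by (simp add: above mult[OF 3 \<open>x \<le> y\<close>])
        with 3 show ?thesis
          using cocycle_add[OF f 3 \<open>x \<le> y\<close>] nonzero[OF 3] by (simp add: above field_simps)
      qed
    qed
    then show ?thesis using \<open>x \<le> y\<close> by (simp add: xs delta_0_pair)
  qed
qed

theorem proposition3p16:
  fixes x0 :: "'a::order"
    and l :: "'a \<Rightarrow> 'a"
    and s :: "'a \<Rightarrow> 'a \<Rightarrow> 'k::field"
  assumes "\<forall>x y :: 'a. finite {x..y}"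
    and "all_comparable x0"
    and "l \<in> Aut"
    and "\<forall>x. (x0 \<le> x \<and> l x0 \<le> x) \<or> (x \<le> x0 \<and> l x \<le> x0) \<longrightarrow> l x \<le> x"
    and "multiplicative s"
  shows "cohomology s l 1 = {cohomology_zero s l 1}"
proof (rule cohomology_trivialI, rule subsetI)
  fix f assume f: "f \<in> cocycles s l 1"
  have "mono l" using \<open>l \<in> Aut\<close> by (auto simp: Aut_def mono_def)
  have "cocycle_potential s l x0 f \<in> cochains_at l 0"
    using f assms(2,4) by (intro cocycle_potential_in_cochains_at) auto
  moreover have "f = delta s l 0 (cocycle_potential s l x0 f)"
    using delta_cocycle_potential[OF f assms(2) \<open>mono l\<close> assms(5)] by simp
  ultimately show "f \<in> coboundaries s l 1"
    unfolding coboundaries_def by auto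
qed

end
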